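(* Let $N\ge 3$ be an integer and $\hat\rho\in[0,1]$, and consider the $N$-player betting game in which player $i$ chooses $p_i\in[0,1]$ and has utility $\mathcal U_i(\vec p,\hat\rho)$ (all players share the same belief $\hat\rho$). Then: (i) If $\hat\rho\in[\tfrac1N,1-\tfrac1N]$, there is a unique symmetric Nash equilibrium, i.e. a unique $p_{\rm eq}\in[0,1]$ such that the profile $(p_{\rm eq},\dots,p_{\rm eq})$ is a Nash equilibrium; it is the solution of $K(p_{\rm eq},N)=\hat\rho$. In particular $p_{\rm eq}=0$ when $\hat\rho=\frac1N$ and $p_{\rm eq}=1$ when $\hat\rho=1-\frac1N$. (ii) If $\hat\rho>1-\frac1N$, the profile in which all players use $p_{\rm eq}=1$ is a symmetric Nash equilibrium. (iii) If $\hat\rho<\frac1N$, the profile in which all players use $p_{\rm eq}=0$ is a symmetric Nash equilibrium. In all these symmetric equilibria the utility of each player is zero.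
   Context: Game: there are $N\ge3$ players. Each player $j$ bets $a_j\in\{0,1\}$ (1 = Heads, 0 = Tails) on an outcome $w\in\{0,1\}$. The payoff of player $i$ is $u_i(\vec a\mid w)=0$ if no $j$ has $a_j=w$, and otherwise $u_i(\vec a\mid w)=N\,\dfrac{\delta_{w,a_i}}{\sum_j\delta_{w,a_j}}-1$, with $\delta$ the Kronecker delta. A strategy $p_j\in[0,1]$ is the probability that player $j$ bets 1; bets are independent across players. Given a strategy profile $\vec p=(p_1,\dots,p_N)$ and a belief $\hat\rho\in[0,1]$, $$\mathcal U_i(\vec p,\hat\rho)=\hat\rho\,\mathbb E_{\vec a}[u_i(\vec a\mid 1)]+(1-\hat\rho)\,\mathbb E_{\vec a}[u_i(\vec a\mid 0)],$$ where under $\mathbb E_{\vec a}$ the $a_j$ are independent Bernoulli($p_j$). A Nash equilibrium is a profile in which no player can increase her utility by changing only her own $p_i\in[0,1]$; it is symmetric if all $p_i$ are equal. $K(p,N)=\dfrac{p-p^N}{1-p^N-(1-p)^N}$ for $p\in(0,1)$, extended by its limits $K(0,N)=\frac1N$, $K(1,N)=1-\frac1N$. *)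

theory Defs
  imports "HOL-Probability.Probability"
begin

text \<open>
  The players are \<open>0, \<dots>, N - 1\<close>. Bets and outcomes are Booleans: \<open>True\<close> stands for 1 (Heads) and
  \<open>False\<close> for 0 (Tails), so that \<open>of_bool (x = y)\<close> is the Kronecker delta. Strategy profiles and
  bet vectors are functions on \<open>nat\<close> of which only the values below \<open>N\<close> matter.
\<close>

definition payoff :: "nat \<Rightarrow> (nat \<Rightarrow> bool) \<Rightarrow> bool \<Rightarrow> nat \<Rightarrow> real" where
  "payoff N a w i =
     (if \<not> (\<exists>j<N. a j = w) then 0
      else real N * (of_bool (a i = w) / (\<Sum>j<N. of_bool (a j = w))) - 1)"

text \<open>
  The third argument of \<open>Pi_pmf\<close> is the distribution of each coordinate in the index set; the
  second, \<open>False\<close>, is only the default value of the coordinates outside of it. Note that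
  \<open>bernoulli_pmf\<close> truncates its parameter to the unit interval, hence the explicit range
  conditions in \<open>nash_equilibrium\<close>.
\<close>

definition bets_pmf :: "nat \<Rightarrow> (nat \<Rightarrow> real) \<Rightarrow> (nat \<Rightarrow> bool) pmf" where
  "bets_pmf N p = Pi_pmf {..<N} False (\<lambda>j. bernoulli_pmf (p j))"

definition utility :: "nat \<Rightarrow> real \<Rightarrow> (nat \<Rightarrow> real) \<Rightarrow> nat \<Rightarrow> real" where
  "utility N \<rho> p i =
     \<rho> * measure_pmf.expectation (bets_pmf N p) (\<lambda>a. payoff N a True i)
     + (1 - \<rho>) * measure_pmf.expectation (bets_pmf N p) (\<lambda>a. payoff N a False i)"

definition nash_equilibrium :: "nat \<Rightarrow> real \<Rightarrow> (nat \<Rightarrow> real) \<Rightarrow> bool" where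
  "nash_equilibrium N \<rho> p \<longleftrightarrow>
     (\<forall>j<N. p j \<in> {0..1}) \<and>
     (\<forall>i<N. \<forall>q\<in>{0..1}. utility N \<rho> (p(i := q)) i \<le> utility N \<rho> p i)"

definition K :: "real \<Rightarrow> nat \<Rightarrow> real" where
  "K p N =
     (if p = 0 then 1 / real N
      else if p = 1 then 1 - 1 / real N
      else (p - p ^ N) / (1 - p ^ N - (1 - p) ^ N))"

end

theory Submission
  imports Defs
begin

text \<open>
  If player \<open>i\<close> deviates to \<open>q\<close> while all others play \<open>p\<close>, the expectation of
  \<open>1 / (1 + S)\<close>, for \<open>S\<close> binomial with parameters \<open>N - 1\<close> and \<open>p\<close>, makes all
  expectations geometric sums. With \<open>g x = 1 + x + \<dots> + x ^ (N - 2)\<close>, the expected payoff given Heads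
  is \<open>(q - p) * g (1 - p)\<close>, and by symmetry the one given Tails is \<open>(p - q) * g p\<close>. Hence the
  utility is \<open>(q - p) * D p\<close> with \<open>D p = \<rho> * g (1 - p) - (1 - \<rho>) * g p\<close>. It vanishes for
  \<open>q = p\<close>, and since \<open>D\<close> is strictly decreasing with \<open>D 0 = N * \<rho> - 1\<close> and
  \<open>D 1 = N * \<rho> - (N - 1)\<close>, the symmetric equilibria can be read off. Moreover
  \<open>K p N = g p / (g p + g (1 - p))\<close>, so that \<open>K p N = \<rho>\<close> is equivalent to \<open>D p = 0\<close>.
\<close>

definition geom_sum :: "nat \<Rightarrow> real \<Rightarrow> real" where
  "geom_sum n x = (\<Sum>k<n. x ^ k)"

definition advantage :: "nat \<Rightarrow> real \<Rightarrow> real \<Rightarrow> real" where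
  "advantage N \<rho> p =
     \<rho> * geom_sum (N - 1) (1 - p) - (1 - \<rho>) * geom_sum (N - 1) p"

section \<open>Expected payoffs after a unilateral deviation\<close>

text \<open>Absorption, (n + 1) * C(n, k) = (k + 1) * C(n + 1, k + 1), turns p times the sum into
  the expansion of (p + (1 - p)) ^ (n + 1) without its first term. The result 1 - (1 - p) ^ (n + 1)
  is p times the geometric sum; cancelling p forces the separate case p = 0.\<close>

lemma binomial_sum_reciprocal:
  fixes p :: real
  shows "(\<Sum>k\<le>n. real (n choose k) * p ^ k * (1 - p) ^ (n - k) * (real (Suc n) / real (Suc k)))
    = geom_sum (Suc n) (1 - p)" (is "?L = _")
proof (cases "p = 0")
  case True
  have "?L = (\<Sum>k\<in>{0}. real (n choose k) * p ^ k * (1 - p) ^ (n - k) * (real (Suc n) / real (Suc k)))"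
    by (rule sum.mono_neutral_right) (auto simp: True)
  then show ?thesis
    by (simp add: True geom_sum_def)
next
  case False
  have term_eq: "p * (real (n choose k) * p ^ k * (1 - p) ^ (n - k) * (real (Suc n) / real (Suc k)))
    = real (Suc n choose Suc k) * p ^ Suc k * (1 - p) ^ (Suc n - Suc k)" for k
  proof -
    have "real (Suc k) * real (Suc n choose Suc k) = real (Suc n) * real (n choose k)"
      by (metis Suc_times_binomial of_nat_mult)
    then have "real (Suc n choose Suc k) = real (n choose k) * (real (Suc n) / real (Suc k))"
      by (simp add: field_simps del: binomial_Suc_Suc)
    then show ?thesis
      by (simp del: binomial_Suc_Suc)
  qed
  have "1 = (\<Sum>k\<le>Suc n. real (Suc n choose k) * p ^ k * (1 - p) ^ (Suc n - k))"
    using binomial_ring[of p "1 - p" "Suc n"] by simp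
  also have "\<dots> = (1 - p) ^ Suc n
      + (\<Sum>k\<le>n. real (Suc n choose Suc k) * p ^ Suc k * (1 - p) ^ (Suc n - Suc k))"
    by (subst sum.atMost_Suc_shift) (simp del: binomial_Suc_Suc)
  also have "\<dots> = (1 - p) ^ Suc n + p * ?L"
    by (simp only: term_eq sum_distrib_left)
  finally have "1 - (1 - p) ^ Suc n = p * ?L"
    by linarith
  moreover have "1 - (1 - p) ^ Suc n = p * geom_sum (Suc n) (1 - p)"
    using one_diff_power_eq[of "1 - p" "Suc n"]
    by (simp add: geom_sum_def del: power_Suc sum.lessThan_Suc)
  ultimately have "p * ?L = p * geom_sum (Suc n) (1 - p)"
    by simp
  with False show ?thesis by simp
qed

text \<open>The other bets enter only through their number \<open>S\<close> of Heads, which makes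
  the expectation binomial. For a bet on Tails, \<open>of_bool (S = 0)\<close> cancels the -1
  exactly when nobody wins and the payoff is 0 by convention.\<close>

lemma payoff_fun_upd_True:
  fixes b :: "nat \<Rightarrow> bool"
  assumes "i < N"
  defines "S \<equiv> card {j \<in> {..<N} - {i}. b j}"
  shows "payoff N (b(i := y)) True i =
    (if y then real N / real (Suc S) else of_bool (S = 0)) - 1"
proof -
  let ?A = "{..<N} - {i}"
  have fin: "finite {j \<in> ?A. b j}" by simp
  have S0: "S = 0 \<longleftrightarrow> (\<forall>j<N. j \<noteq> i \<longrightarrow> \<not> b j)"
    unfolding S_def card_eq_0_iff using fin by auto
  have "(\<Sum>j<N. of_bool ((b(i := y)) j = True)) =
      (of_bool y + (\<Sum>j\<in>?A. of_bool ((b(i := y)) j = True)) :: real)"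
    using assms(1) by (subst sum.remove[of _ i]) auto
  also have "(\<Sum>j\<in>?A. of_bool ((b(i := y)) j = True)) = (\<Sum>j\<in>?A. of_bool (b j) :: real)"
    by (rule sum.cong) auto
  also have "\<dots> = real S"
    unfolding S_def by (simp add: of_bool_def sum.If_cases Int_def)
  finally have "(\<Sum>j<N. of_bool ((b(i := y)) j = True)) = of_bool y + real S" .
  then show ?thesis
    unfolding payoff_def using S0 assms(1) by (auto simp: add.commute)
qed

text \<open>Conditioning on the bet of player \<open>i\<close> leaves a binomial expectation over
  the others. The default \<open>d\<close> is arbitrary because exchanging Heads and Tails below
  also negates the default.\<close>

lemma expectation_payoff_True:
  fixes p q :: real
  assumes i: "i < N" and p: "p \<in> {0..1}" and q: "q \<in> {0..1}"
  shows "measure_pmf.expectation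
      (Pi_pmf {..<N} d (\<lambda>j. bernoulli_pmf (((\<lambda>_. p)(i := q)) j))) (\<lambda>a. payoff N a True i)
    = (q - p) * geom_sum (N - 1) (1 - p)"
proof -
  let ?A = "{..<N} - {i}"
  let ?P = "Pi_pmf ?A d (\<lambda>_. bernoulli_pmf p)"
  let ?S = "\<lambda>b. card {j \<in> ?A. b j}"
  let ?h = "\<lambda>y k. (if y then real N / real (Suc k) else of_bool (k = 0)) - 1"
  obtain n where n: "N = Suc n" using i by (cases N) auto
  have card: "card ?A = n" using i n by simp
  have fin: "finite (set_pmf (?P))"
    by (rule finite_subset[OF set_Pi_pmf_subset']) (auto intro!: finite_PiE_dflt)
  have weights: "(\<Sum>k\<le>n. real (n choose k) * p ^ k * (1 - p) ^ (n - k)) = 1"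
    using binomial_ring[of p "1 - p" n] by simp
  have binom: "measure_pmf.expectation ?P (\<lambda>b. ?h y (?S b)) =
      (\<Sum>k\<le>n. real (n choose k) * p ^ k * (1 - p) ^ (n - k) * ?h y k)" for y
  proof -
    have "measure_pmf.expectation ?P (\<lambda>b. ?h y (?S b)) =
        measure_pmf.expectation (binomial_pmf n p) (?h y)"
      by (subst binomial_pmf_altdef'[OF _ card p, of d]) (simp_all only: integral_map_pmf finite_Diff finite_lessThan)
    then show ?thesis
      by (simp only: expectation_binomial_pmf'[OF p] real_scaleR_def)
  qed
  have heads: "measure_pmf.expectation ?P (\<lambda>b. ?h True (?S b)) = geom_sum N (1 - p) - 1"
    unfolding binom using binomial_sum_reciprocal[of n p] weights
    by (simp add: n right_diff_distrib sum_subtractf)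
  have "(\<Sum>k\<le>n. real (n choose k) * p ^ k * (1 - p) ^ (n - k) * of_bool (k = 0)) =
      (\<Sum>k\<in>{0}. real (n choose k) * p ^ k * (1 - p) ^ (n - k) * of_bool (k = 0))"
    by (rule sum.mono_neutral_right) auto
  then have tails: "measure_pmf.expectation ?P (\<lambda>b. ?h False (?S b)) = (1 - p) ^ n - 1"
    unfolding binom using weights by (simp add: right_diff_distrib sum_subtractf)
  \<comment> \<open>Coordinate \<open>i\<close> is split off, so that its bet is drawn independently
    of the others.\<close>
  have "Pi_pmf {..<N} d (\<lambda>j. bernoulli_pmf (((\<lambda>_. p)(i := q)) j)) =
      Pi_pmf (insert i ?A) d (\<lambda>j. bernoulli_pmf (((\<lambda>_. p)(i := q)) j))"
    using i by (simp add: insert_absorb)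
  also have "\<dots> = bernoulli_pmf q \<bind> (\<lambda>y. map_pmf (\<lambda>b. b(i := y))
      (Pi_pmf ?A d (\<lambda>j. bernoulli_pmf (((\<lambda>_. p)(i := q)) j))))"
    by (subst Pi_pmf_insert') (auto simp: map_pmf_def)
  also have "Pi_pmf ?A d (\<lambda>j. bernoulli_pmf (((\<lambda>_. p)(i := q)) j)) = ?P"
    by (rule Pi_pmf_cong) auto
  finally have "measure_pmf.expectation
      (Pi_pmf {..<N} d (\<lambda>j. bernoulli_pmf (((\<lambda>_. p)(i := q)) j))) (\<lambda>a. payoff N a True i) =
      (\<Sum>y\<in>UNIV. pmf (bernoulli_pmf q) y *
        measure_pmf.expectation ?P (\<lambda>b. payoff N (b(i := y)) True i))"
    using fin by (simp add: pmf_expectation_bind[of UNIV] integral_map_pmf del: fun_upd_apply)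
  also have "\<dots> = q * (geom_sum N (1 - p) - 1) + (1 - q) * ((1 - p) ^ n - 1)"
    using q heads tails by (simp add: UNIV_bool payoff_fun_upd_True[OF i])
  \<comment> \<open>With g = \<open>geom_sum n (1 - p)\<close>, betting Heads yields (1 - p) * g and
    betting Tails yields -p * g; the mixture with weights q and 1 - q is (q - p) * g.\<close>
  also have "geom_sum N (1 - p) = geom_sum n (1 - p) + (1 - p) ^ n"
    by (simp add: geom_sum_def n)
  also have "(1 - p) ^ n = 1 - p * geom_sum n (1 - p)"
    using one_diff_power_eq[of "1 - p" n] by (simp add: geom_sum_def)
  finally show ?thesis by (simp add: n algebra_simps)
qed

text \<open>Negation is written \<open>x = False\<close> to match the comparison with the outcome
  \<open>False\<close> inside \<open>payoff\<close>.\<close>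

lemma map_pmf_Not_bernoulli:
  assumes "p \<in> {0..1}"
  shows "map_pmf (\<lambda>x. x = False) (bernoulli_pmf p) = bernoulli_pmf (1 - p)"
proof (rule pmf_eqI)
  fix b :: bool
  have "pmf (map_pmf Not (bernoulli_pmf p)) (\<not> \<not> b) = pmf (bernoulli_pmf p) (\<not> b)"
    by (rule pmf_map_inj') (auto simp: inj_def)
  then show "pmf (map_pmf (\<lambda>x. x = False) (bernoulli_pmf p)) b = pmf (bernoulli_pmf (1 - p)) b"
    using assms by (cases b) simp_all
qed

text \<open>Exchanging the names of Heads and Tails replaces p and q by 1 - p and 1 - q and reduces
  this to the previous case.\<close>

lemma expectation_payoff_False:
  fixes p q :: real
  assumes i: "i < N" and p: "p \<in> {0..1}" and q: "q \<in> {0..1}"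
  shows "measure_pmf.expectation
      (Pi_pmf {..<N} d (\<lambda>j. bernoulli_pmf (((\<lambda>_. p)(i := q)) j))) (\<lambda>a. payoff N a False i)
    = (p - q) * geom_sum (N - 1) p"
proof -
  let ?P = "Pi_pmf {..<N} d (\<lambda>j. bernoulli_pmf (((\<lambda>_. p)(i := q)) j))"
  let ?f = "\<lambda>x. x = False"
  have "payoff N a False i = payoff N (?f \<circ> a) True i" for a
    unfolding payoff_def o_def by (simp only: eq_True)
  then have "measure_pmf.expectation ?P (\<lambda>a. payoff N a False i) =
      measure_pmf.expectation (map_pmf (\<lambda>a. ?f \<circ> a) ?P) (\<lambda>a. payoff N a True i)"
    by (simp add: integral_map_pmf)
  also have "map_pmf (\<lambda>a. ?f \<circ> a) ?P =
      Pi_pmf {..<N} (?f d) (\<lambda>j. map_pmf ?f (bernoulli_pmf (((\<lambda>_. p)(i := q)) j)))"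
    by (rule Pi_pmf_map[symmetric]) auto
  also have "\<dots> = Pi_pmf {..<N} (?f d) (\<lambda>j. bernoulli_pmf (((\<lambda>_. 1 - p)(i := 1 - q)) j))"
    using p q by (intro Pi_pmf_cong) (auto simp del: eq_False simp: map_pmf_Not_bernoulli)
  finally show ?thesis
    using expectation_payoff_True[of i N "1 - p" "1 - q"] i p q by simp
qed

section \<open>Utility of a deviation and the equilibrium criterion\<close>

lemma utility_deviation:
  assumes "i < N" "p \<in> {0..1}" "q \<in> {0..1}"
  shows "utility N \<rho> ((\<lambda>_. p)(i := q)) i = (q - p) * advantage N \<rho> p"
  unfolding utility_def bets_pmf_def advantage_def
    expectation_payoff_True[OF assms] expectation_payoff_False[OF assms]
  by (simp add: algebra_simps)

lemma utility_symmetric: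
  assumes "i < N" "p \<in> {0..1}"
  shows "utility N \<rho> (\<lambda>_. p) i = 0"
proof -
  have "(\<lambda>_. p)(i := p) = (\<lambda>_. p)" by auto
  then show ?thesis using utility_deviation[OF assms assms(2)] by simp
qed

lemma nash_equilibrium_symmetric_iff:
  assumes "N > 0" "p \<in> {0..1}"
  shows "nash_equilibrium N \<rho> (\<lambda>_. p) \<longleftrightarrow> (\<forall>q\<in>{0..1}. (q - p) * advantage N \<rho> p \<le> 0)"
  unfolding nash_equilibrium_def
  using assms by (auto simp: utility_deviation utility_symmetric)

section \<open>Monotonicity and boundary values of the advantage\<close>

lemma geom_sum_0: "n > 0 \<Longrightarrow> geom_sum n 0 = 1"
  unfolding geom_sum_def by (cases n) (simp_all add: sum.lessThan_Suc_shift del: sum.lessThan_Suc)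

lemma geom_sum_1: "geom_sum n 1 = real n"
  by (simp add: geom_sum_def)

lemma geom_sum_pos:
  assumes "n > 0" "x \<ge> 0"
  shows "geom_sum n x > 0"
proof -
  have "0 < (1::real)" by simp
  also have "1 \<le> geom_sum n x"
    unfolding geom_sum_def using assms
    by (cases n) (simp_all add: sum.lessThan_Suc_shift sum_nonneg del: sum.lessThan_Suc)
  finally show ?thesis .
qed

lemma geom_sum_strict_mono:
  assumes "n \<ge> 2" "0 \<le> x" "x < y"
  shows "geom_sum n x < geom_sum n y"
  unfolding geom_sum_def
proof (rule sum_strict_mono_ex1)
  show "\<forall>k\<in>{..<n}. x ^ k \<le> y ^ k" using assms by (auto intro: power_mono)
  \<comment> \<open>The linear term is present because n is at least 2; this is the source of
    strictness, and of the bound N >= 3 later.\<close>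
  show "\<exists>k\<in>{..<n}. x ^ k < y ^ k" using assms by (intro bexI[of _ 1]) auto
qed simp

lemma advantage_strict_antimono:
  assumes "N \<ge> 3" "\<rho> \<in> {0..1}" "0 \<le> x" "x < y" "y \<le> 1"
  shows "advantage N \<rho> y < advantage N \<rho> x"
proof -
  have n: "N - 1 \<ge> 2" using assms by simp
  have 1: "geom_sum (N - 1) x < geom_sum (N - 1) y"
    using geom_sum_strict_mono[OF n] assms by simp
  have 2: "geom_sum (N - 1) (1 - y) < geom_sum (N - 1) (1 - x)"
    using geom_sum_strict_mono[OF n] assms by simp
  \<comment> \<open>One of the two weights may vanish: for \<rho> = 0 strictness comes from the
    Tails term, otherwise from the Heads term.\<close>
  show ?thesis
  proof (cases "\<rho> = 0")
    case True
    with 1 show ?thesis by (simp add: advantage_def)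
  next
    case False
    then have "\<rho> * geom_sum (N - 1) (1 - y) < \<rho> * geom_sum (N - 1) (1 - x)"
      using 2 assms by simp
    moreover have "(1 - \<rho>) * geom_sum (N - 1) x \<le> (1 - \<rho>) * geom_sum (N - 1) y"
      using 1 assms by (intro mult_left_mono) auto
    ultimately show ?thesis by (simp add: advantage_def)
  qed
qed

lemma advantage_0: "N \<ge> 2 \<Longrightarrow> advantage N \<rho> 0 = \<rho> * real N - 1"
  by (simp add: advantage_def geom_sum_0 geom_sum_1 of_nat_diff algebra_simps)

lemma advantage_1: "N \<ge> 2 \<Longrightarrow> advantage N \<rho> 1 = \<rho> * real N - (real N - 1)"
  by (simp add: advantage_def geom_sum_0 geom_sum_1 of_nat_diff algebra_simps)

section \<open>The function \<open>K\<close> as a ratio of geometric sums\<close>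

text \<open>The denominator of \<open>K\<close> is the sum of p - p ^ N and (1 - p) - (1 - p) ^ N,
  and both contain the factor p * (1 - p), which cancels for interior p. At the endpoints the ratio
  takes the limit values directly.\<close>

lemma K_eq_geom_sum:
  assumes "N \<ge> 2" "p \<in> {0..1}"
  shows "K p N = geom_sum (N - 1) p / (geom_sum (N - 1) p + geom_sum (N - 1) (1 - p))"
proof (cases "p = 0 \<or> p = 1")
  case True
  then show ?thesis
    using assms(1) by (auto simp: K_def geom_sum_0 geom_sum_1 of_nat_diff field_simps)
next
  case False
  let ?g = "geom_sum (N - 1)"
  obtain n where n: "N = Suc n" using assms(1) by (cases N) auto
  have pos: "p * (1 - p) > 0" using False assms by (auto simp: less_le)
  have 1: "1 - p ^ n = (1 - p) * ?g p" and 2: "1 - (1 - p) ^ n = p * ?g (1 - p)"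
    using one_diff_power_eq[of p n] one_diff_power_eq[of "1 - p" n]
    by (simp_all add: geom_sum_def n)
  have num: "p - p ^ N = p * (1 - p) * ?g p"
  proof -
    have "p - p ^ N = p * (1 - p ^ n)" by (simp add: n right_diff_distrib)
    then show ?thesis unfolding 1 by simp
  qed
  have "(1 - p) - (1 - p) ^ N = p * (1 - p) * ?g (1 - p)"
  proof -
    have "(1 - p) - (1 - p) ^ N = (1 - p) * (1 - (1 - p) ^ n)"
      by (simp add: n right_diff_distrib[of "1 - p" 1])
    then show ?thesis unfolding 2 by simp
  qed
  with num have den: "1 - p ^ N - (1 - p) ^ N = p * (1 - p) * (?g p + ?g (1 - p))"
    by (simp add: distrib_left)
  show ?thesis
    using False pos unfolding K_def num den by simp
qed

lemma K_eq_iff_advantage_eq_0: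
  assumes "N \<ge> 2" "p \<in> {0..1}"
  shows "K p N = \<rho> \<longleftrightarrow> advantage N \<rho> p = 0"
proof -
  have "geom_sum (N - 1) p > 0" "geom_sum (N - 1) (1 - p) > 0"
    using assms by (auto intro: geom_sum_pos)
  then show ?thesis
    unfolding K_eq_geom_sum[OF assms] advantage_def by (auto simp: field_simps)
qed

section \<open>Existence and uniqueness of symmetric equilibria\<close>

text \<open>Deviating to 1 shows that the advantage is not positive, deviating to 0 that it is not
  negative. At an endpoint one of these deviations is void, and the range of \<rho> supplies the
  missing sign.\<close>

lemma nash_equilibrium_symmetric_iff_advantage_eq_0:
  assumes N: "N \<ge> 3" and \<rho>: "\<rho> \<in> {1 / real N .. 1 - 1 / real N}" and p: "p \<in> {0..1}"
  shows "nash_equilibrium N \<rho> (\<lambda>_. p) \<longleftrightarrow> advantage N \<rho> p = 0"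
proof
  have N0: "N > 0" using N by simp
  assume "nash_equilibrium N \<rho> (\<lambda>_. p)"
  then have *: "(q - p) * advantage N \<rho> p \<le> 0" if "q \<in> {0..1}" for q
    using that nash_equilibrium_symmetric_iff[OF N0 p] by blast
  have "advantage N \<rho> p \<le> 0"
  proof (cases "p = 1")
    case True
    then show ?thesis using N \<rho> by (simp add: advantage_1 field_simps)
  next
    case False
    with p *[of 1] show ?thesis by (auto simp: mult_le_0_iff)
  qed
  moreover have "advantage N \<rho> p \<ge> 0"
  proof (cases "p = 0")
    case True
    then show ?thesis using N \<rho> by (simp add: advantage_0 field_simps)
  next
    case False
    with p *[of 0] show ?thesis by (auto simp: mult_le_0_iff zero_le_mult_iff)
  qed
  ultimately show "advantage N \<rho> p = 0" by simp
next
  assume "advantage N \<rho> p = 0"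
  then show "nash_equilibrium N \<rho> (\<lambda>_. p)"
    using nash_equilibrium_symmetric_iff[of N p \<rho>] N p by simp
qed

text \<open>The range of \<rho> is exactly the one in which the advantage is nonnegative at 0 and
  nonpositive at 1, so the intermediate value theorem applies.\<close>

lemma ex_advantage_eq_0:
  assumes N: "N \<ge> 3" and \<rho>: "\<rho> \<in> {1 / real N .. 1 - 1 / real N}"
  shows "\<exists>p\<in>{0..1}. advantage N \<rho> p = 0"
proof -
  have "advantage N \<rho> 1 \<le> 0" "0 \<le> advantage N \<rho> 0"
    using N \<rho> by (simp_all add: advantage_0 advantage_1 field_simps)
  moreover have "continuous_on {0..1} (advantage N \<rho>)"
    unfolding advantage_def geom_sum_def by (intro continuous_intros)
  ultimately show ?thesis
    using IVT2'[of "advantage N \<rho>" 1 0 0] by auto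
qed

theorem mainTheorem1:
  fixes N :: nat and \<rho> :: real
  assumes "N \<ge> 3" and "\<rho> \<in> {0..1}"
  shows
    "(\<rho> \<in> {1 / real N .. 1 - 1 / real N} \<longrightarrow>
        (\<exists>!p_eq. p_eq \<in> {0..1} \<and> nash_equilibrium N \<rho> (\<lambda>_. p_eq)) \<and>
        (\<forall>p_eq\<in>{0..1}. nash_equilibrium N \<rho> (\<lambda>_. p_eq) \<longrightarrow>
            (\<forall>p\<in>{0..1}. K p N = \<rho> \<longleftrightarrow> p = p_eq) \<and>
            (\<rho> = 1 / real N \<longrightarrow> p_eq = 0) \<and>
            (\<rho> = 1 - 1 / real N \<longrightarrow> p_eq = 1) \<and>
            (\<forall>i<N. utility N \<rho> (\<lambda>_. p_eq) i = 0)))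
     \<and> (\<rho> > 1 - 1 / real N \<longrightarrow>
        nash_equilibrium N \<rho> (\<lambda>_. 1) \<and> (\<forall>i<N. utility N \<rho> (\<lambda>_. 1) i = 0))
     \<and> (\<rho> < 1 / real N \<longrightarrow>
        nash_equilibrium N \<rho> (\<lambda>_. 0) \<and> (\<forall>i<N. utility N \<rho> (\<lambda>_. 0) i = 0))"
proof (intro conjI impI)
  have N0: "N > 0" and N2: "N \<ge> 2" using assms(1) by simp_all
  \<comment> \<open>Strict decrease allows at most one root. This yields uniqueness, identifies the
    solution of K = \<rho>, and settles the two boundary beliefs, where 0 or 1 is itself a
    root.\<close>
  have inj: "x = y" if "x \<in> {0..1}" "y \<in> {0..1}" "advantage N \<rho> x = 0" "advantage N \<rho> y = 0" for x y
    using that advantage_strict_antimono[OF assms, of x y] advantage_strict_antimono[OF assms, of y x]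
    by (cases x y rule: linorder_cases) auto
  {
    assume \<rho>: "\<rho> \<in> {1 / real N .. 1 - 1 / real N}"
    note nash_iff = nash_equilibrium_symmetric_iff_advantage_eq_0[OF assms(1) \<rho>]
    obtain r where "r \<in> {0..1}" "advantage N \<rho> r = 0"
      using ex_advantage_eq_0[OF assms(1) \<rho>] by blast
    then show "\<exists>!p_eq. p_eq \<in> {0..1} \<and> nash_equilibrium N \<rho> (\<lambda>_. p_eq)"
      using inj nash_iff by blast
    show "\<forall>p_eq\<in>{0..1}. nash_equilibrium N \<rho> (\<lambda>_. p_eq) \<longrightarrow>
            (\<forall>p\<in>{0..1}. K p N = \<rho> \<longleftrightarrow> p = p_eq) \<and>
            (\<rho> = 1 / real N \<longrightarrow> p_eq = 0) \<and>
            (\<rho> = 1 - 1 / real N \<longrightarrow> p_eq = 1) \<and>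
            (\<forall>i<N. utility N \<rho> (\<lambda>_. p_eq) i = 0)"
    proof (intro ballI impI)
      fix p_eq :: real
      assume p_eq: "p_eq \<in> {0..1}" and "nash_equilibrium N \<rho> (\<lambda>_. p_eq)"
      then have root: "advantage N \<rho> p_eq = 0" using nash_iff by blast
      have "K p N = \<rho> \<longleftrightarrow> p = p_eq" if "p \<in> {0..1}" for p
        using K_eq_iff_advantage_eq_0[OF N2 that] inj[OF that p_eq] root by auto
      moreover have "p_eq = 0" if "\<rho> = 1 / real N"
        using inj[OF p_eq _ root, of 0] that N0 N2 by (simp add: advantage_0)
      moreover have "p_eq = 1" if "\<rho> = 1 - 1 / real N"
        using inj[OF p_eq _ root, of 1] that N0 N2 by (simp add: advantage_1 left_diff_distrib)
      ultimately show "(\<forall>p\<in>{0..1}. K p N = \<rho> \<longleftrightarrow> p = p_eq) \<and>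
            (\<rho> = 1 / real N \<longrightarrow> p_eq = 0) \<and>
            (\<rho> = 1 - 1 / real N \<longrightarrow> p_eq = 1) \<and>
            (\<forall>i<N. utility N \<rho> (\<lambda>_. p_eq) i = 0)"
        using p_eq by (auto simp: utility_symmetric)
    qed
  }
  {
    assume "\<rho> > 1 - 1 / real N"
    \<comment> \<open>Every deviation from 1 goes down, so a nonnegative advantage makes it
      unprofitable.\<close>
    then have "advantage N \<rho> 1 \<ge> 0"
      using N0 N2 by (simp add: advantage_1 field_simps)
    then show "nash_equilibrium N \<rho> (\<lambda>_. 1)"
      using nash_equilibrium_symmetric_iff[OF N0, of 1] by (auto simp: mult_le_0_iff)
    show "\<forall>i<N. utility N \<rho> (\<lambda>_. 1) i = 0"
      by (simp add: utility_symmetric)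
  }
  {
    assume "\<rho> < 1 / real N"
    \<comment> \<open>Every deviation from 0 goes up, so a nonpositive advantage makes it
      unprofitable.\<close>
    then have "advantage N \<rho> 0 \<le> 0"
      using N0 N2 by (simp add: advantage_0 field_simps)
    then show "nash_equilibrium N \<rho> (\<lambda>_. 0)"
      using nash_equilibrium_symmetric_iff[OF N0, of 0] by (auto simp: mult_le_0_iff)
    show "\<forall>i<N. utility N \<rho> (\<lambda>_. 0) i = 0"
      by (simp add: utility_symmetric)
  }
qed

end
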